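(* Let $n\ge 1$, let $\xi$ be a Killing vector field on $\mathbb{R}^{n,1}$ and let $X=\eta_{\mu\nu}\xi^\mu\xi^\nu$ be its squared norm, regarded as a function of $x\in\mathbb{R}^{n,1}$. Then the Hamiltonian system on the phase space $T^*\mathbb{R}^{n,1}$ (canonical coordinates $(x^\mu,P_\mu)_{\mu=0,\dots,n}$) with Hamiltonian $$H(x,P)=\frac12\left(\eta^{\mu\nu}P_\mu P_\nu+X(x)\right)$$ is completely integrable; that is, it admits $n+1$ functionally independent, pairwise Poisson commuting conserved quantities.
   Context: $\mathbb{R}^{n,1}$ is the $(n+1)$-dimensional Minkowski spacetime with inertial coordinates $(x^0,x^1,\dots,x^n)$ and metric $\eta=-(dx^0)^2+\sum_{i=1}^n(dx^i)^2$; repeated indices are summed over $0,\dots,n$. A Killing vector field is a vector field $\xi^\mu\partial_\mu$ whose metric dual satisfies $\partial_\mu\xi_\nu+\partial_\nu\xi_\mu=0$; equivalently $\xi_\nu=F_{\mu\nu}x^\mu+f_\nu$ with real constants $F_{\mu\nu}=-F_{\nu\mu}$ and $f_\nu$. The Poisson bracket is the canonical one on $T^*\mathbb{R}^{n,1}$. A conserved quantity is a smooth function on phase space that Poisson commutes with $H$; functionally independent means that the differentials are linearly independent on an open dense subset of phase space. (This Hamiltonian system, restricted to $\xi^\mu P_\mu=0$, describes the Nambu–Goto strings whose world-sheets are invariant under the isometries generated by $\xi$.) *)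

theory Defs
  imports "HOL-Analysis.Analysis"
begin

text \<open>
  With \<open>n = CARD('n)\<close>, the \<open>n + 1\<close> spacetime indices are the elements of \<open>'n option\<close>:
  \<open>None\<close> is the time index \<open>0\<close> and the \<open>Some i\<close> are the spatial indices \<open>1, \<dots>, n\<close>
  (so \<open>n \<ge> 1\<close>, types being nonempty).
\<close>

type_synonym 'n spacetime = "real ^ ('n option)"

text \<open>
  The cotangent bundle of \<open>real ^ 'i\<close>, as pairs \<open>(x, P)\<close> of positions \<open>x $ \<mu>\<close> and covector
  components \<open>P $ \<mu>\<close>. It has dimension \<open>2 * CARD('i)\<close>.
\<close>

type_synonym 'i phase_space = "(real ^ 'i) \<times> (real ^ 'i)"

definition eta :: "'n option \<Rightarrow> 'n option \<Rightarrow> real"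
  where "eta \<mu> \<nu> = (if \<mu> = \<nu> then (if \<mu> = None then - 1 else 1) else 0)"

primrec Ck :: "nat \<Rightarrow> ('a::euclidean_space \<Rightarrow> 'b::real_normed_vector) \<Rightarrow> bool"
  where
    "Ck 0 f \<longleftrightarrow> continuous_on UNIV f"
  | "Ck (Suc k) f \<longleftrightarrow> f differentiable_on UNIV \<and>
       (\<forall>v. Ck k (\<lambda>x. frechet_derivative f (at x) v))"

definition smooth :: "('a::euclidean_space \<Rightarrow> 'b::real_normed_vector) \<Rightarrow> bool"
  where "smooth f \<longleftrightarrow> (\<forall>k. Ck k f)"

definition lower :: "'n::finite spacetime \<Rightarrow> 'n spacetime"
  where "lower v = (\<chi> \<nu>. \<Sum>\<mu>\<in>UNIV. eta \<nu> \<mu> * v $ \<mu>)"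

definition killing_field :: "('n::finite spacetime \<Rightarrow> 'n spacetime) \<Rightarrow> bool"
  where "killing_field \<xi> \<longleftrightarrow> smooth \<xi> \<and>
    (\<forall>x \<mu> \<nu>. frechet_derivative (\<lambda>y. lower (\<xi> y) $ \<nu>) (at x) (axis \<mu> 1)
            + frechet_derivative (\<lambda>y. lower (\<xi> y) $ \<mu>) (at x) (axis \<nu> 1) = 0)"

definition squared_norm :: "('n::finite spacetime \<Rightarrow> 'n spacetime) \<Rightarrow> 'n spacetime \<Rightarrow> real"
  where "squared_norm \<xi> x = (\<Sum>\<mu>\<in>UNIV. \<Sum>\<nu>\<in>UNIV. eta \<mu> \<nu> * \<xi> x $ \<mu> * \<xi> x $ \<nu>)"

definition partial_x :: "'i \<Rightarrow> ('i::finite phase_space \<Rightarrow> real) \<Rightarrow> 'i phase_space \<Rightarrow> real"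
  where "partial_x \<mu> f z = frechet_derivative f (at z) (axis \<mu> 1, 0)"

definition partial_P :: "'i \<Rightarrow> ('i::finite phase_space \<Rightarrow> real) \<Rightarrow> 'i phase_space \<Rightarrow> real"
  where "partial_P \<mu> f z = frechet_derivative f (at z) (0, axis \<mu> 1)"

definition poisson_bracket ::
    "('i::finite phase_space \<Rightarrow> real) \<Rightarrow> ('i phase_space \<Rightarrow> real) \<Rightarrow> 'i phase_space \<Rightarrow> real"
  where "poisson_bracket f g z =
    (\<Sum>\<mu>\<in>UNIV. partial_x \<mu> f z * partial_P \<mu> g z - partial_P \<mu> f z * partial_x \<mu> g z)"

definition conserved_quantity ::
    "('i::finite phase_space \<Rightarrow> real) \<Rightarrow> ('i phase_space \<Rightarrow> real) \<Rightarrow> bool"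
  where "conserved_quantity H f \<longleftrightarrow> smooth f \<and> (\<forall>z. poisson_bracket f H z = 0)"

text \<open>
  Linear independence of the differentials is that of the family \<open>(df\<^sub>j)\<close>, not of the set of its
  members: repeated differentials count as dependent.
\<close>

definition functionally_independent ::
    "('j::finite \<Rightarrow> 'i::finite phase_space \<Rightarrow> real) \<Rightarrow> bool"
  where "functionally_independent F \<longleftrightarrow>
    (\<exists>U. open U \<and> closure U = UNIV \<and>
      (\<forall>z\<in>U. \<forall>c. (\<forall>v. (\<Sum>j\<in>UNIV. c j * frechet_derivative (F j) (at z) v) = 0)
               \<longrightarrow> (\<forall>j. c j = 0)))"

text \<open>
  The family \<open>F\<close> has one member for each element of \<open>'i\<close>, that is, half the dimension of the phase
  space; for \<open>'i = 'n option\<close> these are \<open>n + 1\<close> functions.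
\<close>

definition completely_integrable :: "('i::finite phase_space \<Rightarrow> real) \<Rightarrow> bool"
  where "completely_integrable H \<longleftrightarrow>
    (\<exists>F :: 'i \<Rightarrow> 'i phase_space \<Rightarrow> real.
      (\<forall>j. conserved_quantity H (F j)) \<and>
      (\<forall>j k z. poisson_bracket (F j) (F k) z = 0) \<and>
      functionally_independent F)"

text \<open>
  The inverse metric \<open>\<eta>\<^sup>\<mu>\<^sup>\<nu>\<close> has the same components as \<open>\<eta>\<close> in inertial coordinates, so
  \<open>eta\<close> also contracts the momenta.
\<close>

definition hamiltonian ::
    "('n::finite spacetime \<Rightarrow> 'n spacetime) \<Rightarrow> 'n option phase_space \<Rightarrow> real"
  where "hamiltonian \<xi> = (\<lambda>(x, P).
    1 / 2 * ((\<Sum>\<mu>\<in>UNIV. \<Sum>\<nu>\<in>UNIV. eta \<mu> \<nu> * P $ \<mu> * P $ \<nu>) + squared_norm \<xi> x))"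

end

theory Submission
  imports Defs
begin

text \<open>
  A Killing field is \<open>\<xi> x = A x + b\<close> with \<open>A\<close> skew for \<open>\<eta>\<close>, so \<open>H\<close> is quadratic and it suffices to find
  linear coordinates in which it separates. The form \<open>q(x, y) = \<eta>(A x, A y)\<close> is nonnegative on the
  causal cone, since \<open>A v\<close> is orthogonal to \<open>v\<close>. Minimizing \<open>q(v, v) / (- \<eta>(v, v))\<close> over timelike \<open>v\<close>
  yields a timelike eigenvector of \<open>A\<^sup>2\<close> or, in the limit, a null eigenvector \<open>N\<close> of \<open>A\<close>. In the first
  case \<open>q\<close> is diagonalized on the Euclidean orthogonal complement and \<open>H\<close> is a sum of one-dimensional
  Hamiltonians. A nonzero eigenvalue of \<open>N\<close> comes with the opposite eigenvalue and leads back to the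
  first case. If \<open>A N = 0\<close> (null rotations), the momentum \<open>P(N)\<close> is conserved, and the remaining
  coordinates separate up to the coupling of \<open>P(N)\<close> to the momentum of the conjugate null direction.
\<close>

section \<open>Quadratic integrable systems\<close>

lemma Ck_const: "Ck k (\<lambda>x. c)"
  by (induction k arbitrary: c) (auto simp: differentiable_on_def)

lemma Ck_linear: "bounded_linear f \<Longrightarrow> Ck k f"
proof (cases k)
  case 0
  assume "bounded_linear f"
  then show ?thesis using 0 by (simp add: linear_continuous_on)
next
  case (Suc n)
  assume f: "bounded_linear f"
  have "frechet_derivative f (at x) = f" for x
    using frechet_derivative_at[OF bounded_linear_imp_has_derivative[OF f]] by metis
  then show ?thesis
    using Suc bounded_linear_imp_differentiable_on[OF f] by (simp add: Ck_const)
qed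

lemma Ck_Suc_imp_differentiable: "Ck (Suc k) f \<Longrightarrow> f differentiable (at x)"
  by (auto simp: differentiable_on_def)

lemma Ck_Suc_imp_Ck: "Ck (Suc k) f \<Longrightarrow> Ck k f"
proof (induction k arbitrary: f)
  case 0
  then show ?case by (simp add: differentiable_imp_continuous_on)
next
  case (Suc k)
  then show ?case by auto
qed

lemma frechet_derivative_add:
  "f differentiable (at x) \<Longrightarrow> g differentiable (at x) \<Longrightarrow>
    frechet_derivative (\<lambda>x. f x + g x) (at x) v = frechet_derivative f (at x) v + frechet_derivative g (at x) v"
  using frechet_derivative_at[OF has_derivative_add, of f _ x g]
  by (metis frechet_derivative_works)

lemma frechet_derivative_mult:
  fixes f g :: "'a::euclidean_space \<Rightarrow> real"
  assumes "f differentiable (at x)" "g differentiable (at x)"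
  shows "frechet_derivative (\<lambda>x. f x * g x) (at x) v =
      f x * frechet_derivative g (at x) v + frechet_derivative f (at x) v * g x"
  using frechet_derivative_at[OF has_derivative_mult[OF assms[unfolded frechet_derivative_works]]]
  by metis

lemma Ck_add: "Ck k f \<Longrightarrow> Ck k g \<Longrightarrow> Ck k (\<lambda>x. f x + g x)"
proof (induction k arbitrary: f g)
  case 0
  then show ?case by (auto intro: continuous_intros)
next
  case (Suc k)
  note d = Suc.prems[THEN Ck_Suc_imp_differentiable]
  show ?case using Suc d
    by (auto simp: frechet_derivative_add differentiable_on_def)
qed

lemma Ck_mult:
  fixes f g :: "'a::euclidean_space \<Rightarrow> real"
  shows "Ck k f \<Longrightarrow> Ck k g \<Longrightarrow> Ck k (\<lambda>x. f x * g x)"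
proof (induction k arbitrary: f g)
  case 0
  then show ?case by (auto intro: continuous_intros)
next
  case (Suc k)
  note d = Suc.prems[THEN Ck_Suc_imp_differentiable]
  note c = Suc.prems[THEN Ck_Suc_imp_Ck]
  show ?case using Suc d c
    by (auto simp: frechet_derivative_mult differentiable_on_def intro!: Ck_add)
qed

section \<open>Brackets of functions given by gradients, and dense open sets\<close>

lemma partial_eq:
  assumes "(f has_derivative (\<lambda>h. fst h \<bullet> u + snd h \<bullet> w)) (at z)"
  shows "partial_x \<mu> f z = u $ \<mu>" and "partial_P \<mu> f z = w $ \<mu>"
  by (simp_all add: partial_x_def partial_P_def inner_axis' flip: frechet_derivative_at[OF assms])

lemma poisson_bracket_eq:
  assumes "(f has_derivative (\<lambda>h. fst h \<bullet> u + snd h \<bullet> w)) (at z)"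
    and "(g has_derivative (\<lambda>h. fst h \<bullet> u' + snd h \<bullet> w')) (at z)"
  shows "poisson_bracket f g z = u \<bullet> w' - w \<bullet> u'"
  by (simp add: poisson_bracket_def partial_eq[OF assms(1)] partial_eq[OF assms(2)]
      inner_vec_def sum_subtractf)

text \<open>An open set and its intersection with a dense set have the same closure, which carries
  density through the induction on \<open>I\<close>.\<close>

lemma open_dense_INT:
  fixes U :: "'j \<Rightarrow> 'a::topological_space set"
  assumes "finite I" "\<And>i. i \<in> I \<Longrightarrow> open (U i)" "\<And>i. i \<in> I \<Longrightarrow> closure (U i) = UNIV"
  shows "open (\<Inter>i\<in>I. U i) \<and> closure (\<Inter>i\<in>I. U i) = UNIV"
  using assms
proof (induction I rule: finite_induct)
  case (insert i I)
  then have "closure (U i \<inter> (\<Inter>i\<in>I. U i)) = closure (U i)"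
    by (intro closure_open_Int_superset) auto
  with insert show ?case by auto
qed auto

lemma dense_non_hyperplane:
  fixes a :: "'a::euclidean_space"
  assumes "a \<noteq> 0 \<or> k \<noteq> 0"
  shows "closure {z. a \<bullet> z + k \<noteq> 0} = UNIV"
proof (cases "a = 0")
  case False
  have "{z. a \<bullet> z + k \<noteq> 0} = - {z. a \<bullet> z = - k}" by auto
  then show ?thesis using interior_hyperplane[OF False] by (simp add: closure_complement)
qed (use assms in auto)

text \<open>
  The summands of \<open>H\<close> may share only the momentum \<open>P \<bullet> e l\<close>, which then has to be conserved;
  a vanishing weight \<open>s l\<close> allows \<open>F l = P \<bullet> e l\<close> although it is not a summand of \<open>H\<close>.
\<close>

lemma quadratic_completely_integrable:
  fixes e a :: "'i::finite \<Rightarrow> real ^ 'i" and \<alpha> \<beta> \<gamma> \<delta> \<kappa> s :: "'i \<Rightarrow> real"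
  assumes dual: "\<And>i j. a i \<bullet> e j = (if i = j then 1 else 0)"
    and H: "\<And>x P. H (x, P) = E + (\<Sum>j\<in>UNIV. s j *
      (\<alpha> j / 2 * (P \<bullet> e j)\<^sup>2 + \<beta> j * (P \<bullet> e j) * (P \<bullet> e l) + \<gamma> j / 2 * (a j \<bullet> x)\<^sup>2
        + \<delta> j * (a j \<bullet> x) + \<kappa> j * (P \<bullet> e j)))"
    and \<beta>l: "\<beta> l = 0"
    and coupling: "(\<gamma> l = 0 \<and> \<delta> l = 0) \<or> (\<forall>j. \<beta> j = 0)"
    and nontrivial: "\<And>j. \<alpha> j \<noteq> 0 \<or> \<beta> j \<noteq> 0 \<or> \<kappa> j \<noteq> 0"
  shows "completely_integrable H"
proof -
  define F where "F j = (\<lambda>z::'i phase_space.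
      \<alpha> j / 2 * (snd z \<bullet> e j)\<^sup>2 + \<beta> j * (snd z \<bullet> e j) * (snd z \<bullet> e l) + \<gamma> j / 2 * (a j \<bullet> fst z)\<^sup>2
        + \<delta> j * (a j \<bullet> fst z) + \<kappa> j * (snd z \<bullet> e j))" for j
  \<comment> \<open>\<open>u j\<close> and \<open>w j\<close> are the position and momentum
    gradients of \<open>F j\<close>; the coupling adds a component along \<open>e l\<close> to the
    latter.\<close>
  define u where "u j z = (\<gamma> j * (a j \<bullet> fst z) + \<delta> j) *\<^sub>R a j" for j and z :: "'i phase_space"
  define p where "p j z = \<alpha> j * (snd z \<bullet> e j) + \<beta> j * (snd z \<bullet> e l) + \<kappa> j" for j and z :: "'i phase_space"
  define w where "w j z = p j z *\<^sub>R e j + (\<beta> j * (snd z \<bullet> e j)) *\<^sub>R e l" for j and z :: "'i phase_space"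
  have dF: "(F j has_derivative (\<lambda>h. fst h \<bullet> u j z + snd h \<bullet> w j z)) (at z)" for j z
    unfolding F_def u_def w_def p_def
    by (rule has_derivative_eq_rhs, (rule derivative_intros)+)
       (auto simp: fun_eq_iff algebra_simps inner_commute)
  have Heq: "H = (\<lambda>z. E + (\<Sum>j\<in>UNIV. s j * F j z))"
    by (auto simp: fun_eq_iff H F_def)
  have dH: "(H has_derivative (\<lambda>h. fst h \<bullet> (\<Sum>j\<in>UNIV. s j *\<^sub>R u j z) + snd h \<bullet> (\<Sum>j\<in>UNIV. s j *\<^sub>R w j z))) (at z)" for z
    unfolding Heq
    by (rule has_derivative_eq_rhs, (rule derivative_intros dF)+)
       (auto simp: fun_eq_iff inner_sum_right sum.distrib algebra_simps)
  \<comment> \<open>For distinct indices duality leaves only pairings of \<open>u l\<close> with the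
    \<open>e l\<close> part of some \<open>w j\<close>. By \<open>coupling\<close>, either
    \<open>u l\<close> or every \<open>\<beta> j\<close> is zero.\<close>
  have uw: "u j z \<bullet> w k z - w j z \<bullet> u k z = 0" for j k z
  proof (cases "j = k")
    case True
    then show ?thesis by (simp add: inner_commute)
  next
    case False
    then show ?thesis using coupling
      by (auto simp: u_def w_def dual inner_add inner_commute[of "e _"])
  qed
  have "poisson_bracket (F j) (F k) z = 0" for j k z
    using uw by (simp add: poisson_bracket_eq[OF dF dF])
  moreover have "poisson_bracket (F j) H z = 0" for j z
  proof -
    have "poisson_bracket (F j) H z = (\<Sum>k\<in>UNIV. s k * (u j z \<bullet> w k z - w j z \<bullet> u k z))"
      by (simp add: poisson_bracket_eq[OF dF dH] inner_sum_right sum_subtractf algebra_simps)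
    then show ?thesis by (simp add: uw)
  qed
  moreover have "smooth (F j)" for j
    unfolding smooth_def F_def power2_eq_square
    by (intro allI Ck_add Ck_mult Ck_const Ck_linear bounded_linear_intros)
  moreover have "functionally_independent F"
    unfolding functionally_independent_def
  proof (intro exI conjI ballI allI impI)
    define U where "U = (\<Inter>j\<in>UNIV. {z. p j z \<noteq> 0})"
    have p_eq: "{z. p j z \<noteq> 0} = {z. (0, \<alpha> j *\<^sub>R e j + \<beta> j *\<^sub>R e l) \<bullet> z + \<kappa> j \<noteq> 0}" for j
      by (auto simp: p_def inner_add inner_commute)
    have "(0, \<alpha> j *\<^sub>R e j + \<beta> j *\<^sub>R e l) \<noteq> (0 :: 'i phase_space) \<or> \<kappa> j \<noteq> 0" for j
    proof -
      \<comment> \<open>Pairing with the dual vectors reads off the coefficients, so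
        \<open>p j\<close> is constant only if both vanish; then it equals
        \<open>\<kappa> j \<noteq> 0\<close>.\<close>
      have "a j \<bullet> (\<alpha> j *\<^sub>R e j + \<beta> j *\<^sub>R e l) = \<alpha> j"
        "j \<noteq> l \<Longrightarrow> a l \<bullet> (\<alpha> j *\<^sub>R e j + \<beta> j *\<^sub>R e l) = \<beta> j"
        using \<beta>l by (auto simp: inner_add dual)
      then show ?thesis using nontrivial[of j] \<beta>l
        by (cases "j = l") (auto simp: zero_prod_def simp del: inner_add_right inner_scaleR_right)
    qed
    then have "closure {z. p j z \<noteq> 0} = UNIV" for j
      unfolding p_eq by (rule dense_non_hyperplane)
    moreover have "open {z. p j z \<noteq> 0}" for j
      unfolding p_def by (intro open_Collect_neq continuous_intros)
    ultimately have "open U \<and> closure U = UNIV"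
      unfolding U_def by (intro open_dense_INT) auto
    then show "open U" "closure U = UNIV" by auto
    fix z c j
    assume z: "z \<in> U" and c: "\<forall>v. (\<Sum>j\<in>UNIV. c j * frechet_derivative (F j) (at z) v) = 0"
    \<comment> \<open>Testing the relation on the momentum direction \<open>(0, a k)\<close>
      isolates \<open>c k * p k z\<close>. Only \<open>k = l\<close> receives coupling terms, and
      these disappear once the other coefficients are known to vanish.\<close>
    have *: "c k * p k z + (if k = l then \<Sum>j\<in>UNIV. c j * (\<beta> j * (snd z \<bullet> e j)) else 0) = 0" for k
    proof -
      have "0 = (\<Sum>j\<in>UNIV. c j * (a k \<bullet> w j z))"
        using c[rule_format, of "(0, a k)"] by (simp flip: frechet_derivative_at[OF dF])
      also have "\<dots> = (\<Sum>j\<in>UNIV. (if k = j then c j * p j z else 0)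
          + (if k = l then c j * (\<beta> j * (snd z \<bullet> e j)) else 0))"
        by (intro sum.cong) (auto simp: w_def dual inner_add algebra_simps)
      finally show ?thesis by (cases "k = l") (simp_all add: sum.distrib)
    qed
    have p0: "p k z \<noteq> 0" for k using z by (auto simp: U_def)
    have c0: "c k = 0" if "k \<noteq> l" for k using *[of k] p0[of k] that by simp
    have "c j * (\<beta> j * (snd z \<bullet> e j)) = 0" for j
      using c0[of j] \<beta>l by (cases "j = l") auto
    then have "(\<Sum>j\<in>UNIV. c j * (\<beta> j * (snd z \<bullet> e j))) = 0" by (intro sum.neutral) simp
    then have "c l = 0" using *[of l] p0[of l] by simp
    with c0 show "c j = 0" by metis
  qed
  ultimately show ?thesis
    unfolding completely_integrable_def conserved_quantity_def by blast
qed

section \<open>Simultaneous diagonalization\<close>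

text \<open>First-order condition at an interior minimum. It turns the minimizations below into
  eigenvector equations.\<close>

lemma local_min_linear_term_zero:
  fixes b c \<epsilon> :: real
  assumes "\<epsilon> > 0" and nn: "\<And>t. \<bar>t\<bar> < \<epsilon> \<Longrightarrow> 0 \<le> 2 * t * b + t\<^sup>2 * c"
  shows "b = 0"
proof -
  have "((\<lambda>t. 2 * t * b + t\<^sup>2 * c) has_field_derivative 2 * b) (at 0)"
    by (auto intro!: derivative_eq_intros)
  from DERIV_local_min[OF this \<open>\<epsilon> > 0\<close>] nn show ?thesis by auto
qed

text \<open>A minimizer of the Rayleigh quotient of \<open>q\<close> by \<open>g\<close> is an
  eigenvector, and the induction continues in its \<open>g\<close>-orthogonal complement. Positivity
  is asked on \<open>W\<close> alone because the Minkowski form is positive only on suitable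
  subspaces.\<close>

lemma simultaneous_diagonalization:
  fixes g q :: "'a::euclidean_space \<Rightarrow> 'a \<Rightarrow> real" and I :: "'b set"
  assumes g: "bounded_bilinear g" and q: "bounded_bilinear q"
    and g_sym: "\<And>x y. g x y = g y x" and q_sym: "\<And>x y. q x y = q y x"
    and "finite I" "subspace W" "card I \<le> dim W"
    and pos: "\<And>x. x \<in> W \<Longrightarrow> x \<noteq> 0 \<Longrightarrow> g x x > 0"
  shows "\<exists>e. (\<forall>i\<in>I. e i \<in> W) \<and> (\<forall>i\<in>I. \<forall>j\<in>I. g (e i) (e j) = (if i = j then 1 else 0)) \<and>
    (\<forall>i\<in>I. \<forall>j\<in>I. i \<noteq> j \<longrightarrow> q (e i) (e j) = 0)"
  using \<open>finite I\<close> \<open>subspace W\<close> \<open>card I \<le> dim W\<close> pos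
proof (induction I arbitrary: W rule: finite_induct)
  case empty
  then show ?case by auto
next
  case (insert i I)
  interpret g: bounded_bilinear g by (rule g)
  interpret q: bounded_bilinear q by (rule q)
  note W = \<open>subspace W\<close> and pos = insert.prems(3)
  define K where "K = W \<inter> sphere 0 1"
  have "compact K"
    unfolding K_def using closed_subspace[OF W] by (simp add: closed_Int_compact)
  have "dim W \<noteq> 0" using insert.prems(2) card_insert_disjoint[OF insert.hyps] by linarith
  then obtain w0 where w0: "w0 \<in> W" "w0 \<noteq> 0" by (auto simp: dim_eq_0)
  then have "w0 /\<^sub>R norm w0 \<in> K"
    by (simp add: K_def subspace_scale[OF W])
  then have "K \<noteq> {}" by auto
  have posK: "g x x > 0" if "x \<in> K" for x using that pos[of x] by (cases "x = 0") (auto simp: K_def)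
  have cont: "continuous_on K (\<lambda>x. q x x / g x x)"
    using posK by (intro continuous_intros q.continuous_on g.continuous_on) fastforce
  obtain v0 where v0: "v0 \<in> K" and min: "\<And>x. x \<in> K \<Longrightarrow> q v0 v0 / g v0 v0 \<le> q x x / g x x"
    using continuous_attains_inf[OF \<open>compact K\<close> \<open>K \<noteq> {}\<close> cont] by blast
  define m where "m = q v0 v0 / g v0 v0"
  have psd: "q x x - m * g x x \<ge> 0" if x: "x \<in> W" for x
  proof (cases "x = 0")
    case False
    then have "x /\<^sub>R norm x \<in> K"
      using x by (simp add: K_def subspace_scale[OF W])
    from min[OF this] have "m \<le> q x x / g x x"
      using False by (simp add: m_def g.scaleR_left g.scaleR_right q.scaleR_left q.scaleR_right)
    with pos[OF x False] show ?thesis by (simp add: field_simps)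
  qed (simp add: g.zero_left q.zero_left)
  define v where "v = v0 /\<^sub>R sqrt (g v0 v0)"
  have gv0: "g v0 v0 > 0" using posK v0 by blast
  have vW: "v \<in> W" using v0 by (simp add: v_def K_def subspace_scale[OF W])
  have "inverse (sqrt (g v0 v0)) * inverse (sqrt (g v0 v0)) = 1 / g v0 v0"
    using gv0 by (simp add: divide_inverse flip: inverse_mult_distrib)
  then have gvv: "g v v = 1" and qvv: "q v v = m"
    using gv0 by (simp_all add: v_def g.scaleR_left g.scaleR_right q.scaleR_left q.scaleR_right m_def
        mult.assoc[symmetric] del: mult.assoc)
  have eigen: "q v x = m * g v x" if x: "x \<in> W" for x
  proof -
    have "q v x - m * g v x = 0"
    proof (rule local_min_linear_term_zero[of 1])
      fix t :: real
      have "0 \<le> q (v + t *\<^sub>R x) (v + t *\<^sub>R x) - m * g (v + t *\<^sub>R x) (v + t *\<^sub>R x)"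
        using x vW by (intro psd subspace_add subspace_scale W)
      also have "\<dots> = 2 * t * (q v x - m * g v x) + t\<^sup>2 * (q x x - m * g x x)"
        by (simp add: g.add_left g.add_right g.scaleR_left g.scaleR_right q.add_left q.add_right
            q.scaleR_left q.scaleR_right gvv qvv g_sym[of x v] q_sym[of x v] algebra_simps power2_eq_square)
      finally show "0 \<le> 2 * t * (q v x - m * g v x) + t\<^sup>2 * (q x x - m * g x x)" .
    qed simp
    then show ?thesis by simp
  qed
  \<comment> \<open>Every vector of \<open>W\<close> is a multiple of \<open>v\<close> plus an
    element of \<open>W'\<close>, so passing to \<open>W'\<close> costs at most one
    dimension.\<close>
  define W' where "W' = {w \<in> W. g v w = 0}"
  have W': "subspace W'"
    using W by (auto simp: W'_def subspace_def g.add_right g.scaleR_right g.zero_right)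
  have "W \<subseteq> span (Set.insert v W')"
  proof
    fix w assume "w \<in> W"
    then have "w - g v w *\<^sub>R v \<in> W'"
      using vW by (simp add: W'_def subspace_diff[OF W] subspace_scale[OF W] g.diff_right g.scaleR_right gvv)
    then have "(w - g v w *\<^sub>R v) + g v w *\<^sub>R v \<in> span (Set.insert v W')"
      by (intro span_add span_scale) (auto intro: span_base)
    then show "w \<in> span (Set.insert v W')" by simp
  qed
  then have "dim W \<le> dim (Set.insert v W')"
    by (metis dim_span dim_subset)
  also have "\<dots> \<le> dim W' + 1" by (simp add: dim_insert)
  finally have dim: "card I \<le> dim W'" using insert.prems(2) card_insert_disjoint[OF insert.hyps] by linarith
  have "\<And>x. x \<in> W' \<Longrightarrow> x \<noteq> 0 \<Longrightarrow> g x x > 0" using pos by (simp add: W'_def)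
  from insert.IH[OF W' dim this] obtain e where
    e': "(\<forall>i\<in>I. e i \<in> W') \<and> (\<forall>i\<in>I. \<forall>j\<in>I. g (e i) (e j) = (if i = j then 1 else 0)) \<and>
      (\<forall>i\<in>I. \<forall>j\<in>I. i \<noteq> j \<longrightarrow> q (e i) (e j) = 0)"
    by (rule exE)
  have e: "e i \<in> W'" if "i \<in> I" for i using e' that by simp
  have ge: "g (e i) (e j) = (if i = j then 1 else 0)" if "i \<in> I" "j \<in> I" for i j using e' that by simp
  have qe: "q (e i) (e j) = 0" if "i \<in> I" "j \<in> I" "i \<noteq> j" for i j using e' that by simp
  have ev: "g v (e j) = 0" "g (e j) v = 0" "q v (e j) = 0" "q (e j) v = 0" "e j \<in> W" if "j \<in> I" for j
    using e[OF that] eigen[of "e j"] g_sym[of "e j" v] q_sym[of "e j" v] by (auto simp: W'_def)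
  show ?case
  proof (intro exI[of _ "e(i := v)"] conjI ballI impI)
    fix j k assume jk: "j \<in> Set.insert i I" "k \<in> Set.insert i I"
    then show "g ((e(i := v)) j) ((e(i := v)) k) = (if j = k then 1 else 0)"
      using ge ev gvv \<open>i \<notin> I\<close> by auto
    assume "j \<noteq> k"
    then show "q ((e(i := v)) j) ((e(i := v)) k) = 0"
      using qe ev \<open>i \<notin> I\<close> jk by auto
  next
    fix j assume "j \<in> Set.insert i I"
    then show "(e(i := v)) j \<in> W" using ev vW by auto
  qed
qed

text \<open>Duality makes the coordinate map surjective, hence injective by equality of dimensions,
  and both sides have the same coordinates.\<close>

lemma dual_basis_expansion:
  fixes a e :: "'i::finite \<Rightarrow> real ^ 'i"
  assumes dual: "\<And>i j. a i \<bullet> e j = (if i = j then 1 else 0)"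
  shows "x = (\<Sum>j\<in>UNIV. (a j \<bullet> x) *\<^sub>R e j)"
proof -
  define coord where "coord = (\<lambda>x. \<chi> j. a j \<bullet> x)"
  have lin: "linear coord"
    by (auto simp: coord_def linear_iff vec_eq_iff inner_add)
  have coord: "coord (\<Sum>j\<in>UNIV. c $ j *\<^sub>R e j) = c" for c
    by (simp add: coord_def vec_eq_iff inner_sum_right dual if_distrib cong: if_cong)
  then have "surj coord" unfolding surj_def by metis
  then have "inj coord" using linear_surjective_imp_injective[OF lin] by simp
  moreover have "coord (\<Sum>j\<in>UNIV. (a j \<bullet> x) *\<^sub>R e j) = coord x"
    using coord[of "coord x"] by (simp add: coord_def)
  ultimately have "(\<Sum>j\<in>UNIV. (a j \<bullet> x) *\<^sub>R e j) = x" by (rule injD)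
  then show ?thesis by (rule sym)
qed

section \<open>The Minkowski form\<close>

text \<open>The Euclidean inner product with the sign of the time term flipped.\<close>

definition mink :: "'n::finite spacetime \<Rightarrow> 'n spacetime \<Rightarrow> real"
  where "mink x y = x \<bullet> y - 2 * x $ None * y $ None"

interpretation mink: bounded_bilinear mink
  unfolding mink_def
  by (subst bilinear_conv_bounded_bilinear[symmetric])
     (auto simp: bilinear_def linear_iff inner_add algebra_simps)

lemma mink_commute: "mink x y = mink y x"
  by (simp add: mink_def inner_commute)

lemma lower_nth: "lower x $ \<mu> = (if \<mu> = None then - (x $ \<mu>) else x $ \<mu>)"
proof -
  have "(\<Sum>\<nu>\<in>UNIV. eta \<mu> \<nu> * x $ \<nu>) =
      (\<Sum>\<nu>\<in>UNIV. if \<nu> = \<mu> then (if \<mu> = None then - (x $ \<mu>) else x $ \<mu>) else 0)"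
    by (intro sum.cong) (auto simp: eta_def)
  then show ?thesis by (simp add: lower_def)
qed

lemma linear_lower: "linear lower"
  by (auto simp: linear_iff vec_eq_iff lower_nth)

lemma lower_lower [simp]: "lower (lower x) = x"
  by (simp add: vec_eq_iff lower_nth)

lemma inner_lower: "x \<bullet> lower y = mink x y"
proof -
  have "x \<bullet> lower y = (\<Sum>\<mu>\<in>UNIV. x $ \<mu> * y $ \<mu> - (if \<mu> = None then 2 * x $ None * y $ None else 0))"
    by (auto simp: inner_vec_def lower_nth intro!: sum.cong)
  then show ?thesis by (simp add: mink_def inner_vec_def sum_subtractf)
qed

lemma lower_inner: "lower x \<bullet> y = mink x y"
  by (metis inner_commute inner_lower mink_commute)

lemma mink_lower_lower [simp]: "mink (lower x) (lower y) = mink x y"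
  by (metis inner_lower lower_inner lower_lower)

lemma mink_lower: "mink x (lower y) = x \<bullet> y" "mink (lower x) y = x \<bullet> y"
  by (metis inner_lower lower_lower) (metis lower_inner lower_lower)

lemma sum_eta: "(\<Sum>\<mu>\<in>UNIV. \<Sum>\<nu>\<in>UNIV. eta \<mu> \<nu> * x $ \<mu> * y $ \<nu>) = mink x y"
proof -
  have "mink x y = (\<Sum>\<mu>\<in>UNIV. x $ \<mu> * (\<Sum>\<nu>\<in>UNIV. eta \<mu> \<nu> * y $ \<nu>))"
    by (simp add: inner_vec_def lower_def flip: inner_lower)
  then show ?thesis by (simp add: sum_distrib_left mult_ac)
qed

lemma mink_nondegenerate: "(\<And>w. mink u w = 0) \<Longrightarrow> u = 0"
  by (metis inner_eq_zero_iff inner_lower lower_lower)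

text \<open>Subtracting \<open>(x $ None) *\<^sub>R v\<close> from \<open>x\<close> leaves a purely
  spatial vector, on which \<open>mink\<close> is Euclidean. Its square is \<open>mink x x\<close>
  plus a nonpositive multiple of the square of \<open>x $ None\<close>.\<close>

lemma mink_causal_orthogonal:
  assumes v: "v $ None = 1" "mink v v \<le> 0" and x: "mink x v = 0"
  shows "mink x x \<ge> 0" and "mink x x = 0 \<Longrightarrow> x = (x $ None) *\<^sub>R v"
proof -
  define y where "y = x - (x $ None) *\<^sub>R v"
  have "y $ None = 0" using v by (simp add: y_def)
  then have "y \<bullet> y = mink y y" by (simp add: mink_def)
  also have "\<dots> = mink x x + (x $ None)\<^sup>2 * mink v v"
    using x by (simp add: y_def mink.diff_left mink.diff_right mink.scaleR_left mink.scaleR_right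
        mink_commute[of v x] power2_eq_square)
  finally have *: "mink x x = y \<bullet> y + (x $ None)\<^sup>2 * (- mink v v)" by simp
  have nn: "(x $ None)\<^sup>2 * (- mink v v) \<ge> 0" using v by (intro mult_nonneg_nonneg) auto
  with * show "mink x x \<ge> 0" by (metis add_nonneg_nonneg inner_ge_zero)
  assume "mink x x = 0"
  then have "y \<bullet> y = 0" using * nn inner_ge_zero[of y] by linarith
  then show "x = (x $ None) *\<^sub>R v" by (simp add: y_def)
qed

lemma timelike_nonzero_time: "mink v v < 0 \<Longrightarrow> v $ None \<noteq> 0"
  by (rule notI) (simp add: mink_def flip: not_le)

text \<open>Rescaling \<open>v\<close> to unit time component reduces this to the causal case. If
  \<open>mink x x\<close> were zero, \<open>x\<close> would be a multiple of \<open>v\<close>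
  orthogonal to \<open>v\<close>, hence zero.\<close>

lemma mink_timelike_orthogonal_pos:
  assumes "mink v v < 0" "mink x v = 0" "x \<noteq> 0"
  shows "mink x x > 0"
proof -
  define u where "u = v /\<^sub>R v $ None"
  have nz: "v $ None \<noteq> 0" using timelike_nonzero_time assms by blast
  have "mink u u = (inverse (v $ None))\<^sup>2 * mink v v"
    by (simp add: u_def mink.scaleR_left mink.scaleR_right power2_eq_square)
  then have u: "u $ None = 1" "mink u u < 0" "mink x u = 0"
    using assms nz by (simp_all add: u_def mink.scaleR_right mult_pos_neg)
  note c = mink_causal_orthogonal[OF u(1) less_imp_le[OF u(2)] u(3)]
  have "mink x x \<noteq> 0"
  proof
    assume "mink x x = 0"
    from c(2)[OF this] obtain t where t: "x = t *\<^sub>R u" ..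
    then have "t = 0" using u by (simp add: mink.scaleR_left)
    then show False using t \<open>x \<noteq> 0\<close> by simp
  qed
  with c(1) show ?thesis by linarith
qed

section \<open>Killing fields\<close>

text \<open>Exchanging the two indices of the double sum reverses its sign.\<close>

lemma inner_eq_0_if_matrix_antisym:
  fixes L :: "real ^ 'i \<Rightarrow> real ^ 'i"
  assumes "linear L" and antisym: "\<And>\<mu> \<nu>. L (axis \<mu> 1) $ \<nu> + L (axis \<nu> 1) $ \<mu> = 0"
  shows "L v \<bullet> v = 0"
proof -
  interpret linear L by fact
  have L: "L v = (\<Sum>\<mu>\<in>UNIV. v $ \<mu> *\<^sub>R L (axis \<mu> 1))"
    by (subst basis_expansion[of v, symmetric]) (simp add: sum scale scalar_mult_eq_scaleR)
  define S where "S = (\<Sum>\<nu>\<in>UNIV. \<Sum>\<mu>\<in>UNIV. v $ \<mu> * v $ \<nu> * L (axis \<mu> 1) $ \<nu>)"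
  have "L v \<bullet> v = S"
    by (simp add: L S_def inner_vec_def sum_distrib_left mult_ac)
  moreover have "S = - S"
  proof -
    have "S = (\<Sum>\<nu>\<in>UNIV. \<Sum>\<mu>\<in>UNIV. - (v $ \<nu> * v $ \<mu> * L (axis \<nu> 1) $ \<mu>))"
      unfolding S_def using antisym
      by (intro sum.cong refl) (metis add_eq_0_iff minus_mult_right mult.commute)
    also have "\<dots> = - S"
      by (subst sum.swap) (simp add: S_def sum_negf)
    finally show ?thesis .
  qed
  ultimately show ?thesis by simp
qed

text \<open>The \<open>v\<close>-component of a Killing field is constant along lines in direction \<open>v\<close>.\<close>

lemma killing_field_orthogonal:
  assumes \<xi>: "killing_field \<xi>"
  shows "mink (\<xi> x - \<xi> y) (x - y) = 0"
proof -
  define D where "D z = frechet_derivative \<xi> (at z)" for z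
  define v where "v = x - y"
  have "Ck (Suc 0) \<xi>" using \<xi> by (simp add: killing_field_def smooth_def del: Ck.simps)
  then have D: "(\<xi> has_derivative D z) (at z)" for z
    unfolding D_def using Ck_Suc_imp_differentiable frechet_derivative_works by blast
  have lin: "linear (D z)" for z
    using D has_derivative_linear by blast
  have "frechet_derivative (\<lambda>y. lower (\<xi> y) $ \<nu>) (at z) = (\<lambda>h. lower (D z h) $ \<nu>)" for \<nu> z
  proof (rule frechet_derivative_at[symmetric])
    have "bounded_linear (\<lambda>u. lower u $ \<nu>)"
      by (intro bounded_linear_compose[OF bounded_linear_vec_nth] linear_conv_bounded_linear[THEN iffD1] linear_lower)
    from bounded_linear.has_derivative[OF this D]
    show "((\<lambda>y. lower (\<xi> y) $ \<nu>) has_derivative (\<lambda>h. lower (D z h) $ \<nu>)) (at z)" .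
  qed
  then have antisym: "lower (D z (axis \<mu> 1)) $ \<nu> + lower (D z (axis \<nu> 1)) $ \<mu> = 0" for z \<mu> \<nu>
    using \<xi> by (simp add: killing_field_def)
  have "linear (\<lambda>h. lower (D z h))" for z
    using linear_compose[OF lin linear_lower] by (simp add: o_def)
  then have zero: "mink (D z v) v = 0" for z
    using inner_eq_0_if_matrix_antisym[of "\<lambda>h. lower (D z h)" v] antisym by (simp add: lower_inner)
  define \<phi> where "\<phi> t = mink (\<xi> (y + t *\<^sub>R v)) v" for t
  have "(\<phi> has_real_derivative 0) (at t within {0..1})" for t
  proof -
    have "((\<lambda>t. \<xi> (y + t *\<^sub>R v)) has_derivative (\<lambda>h. D (y + t *\<^sub>R v) (h *\<^sub>R v))) (at t)"
      by (rule has_derivative_compose[OF _ D]) (auto intro!: derivative_eq_intros)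
    from bounded_linear.has_derivative[OF mink.bounded_linear_left this]
    have "(\<phi> has_derivative (\<lambda>h. mink (D (y + t *\<^sub>R v) (h *\<^sub>R v)) v)) (at t)"
      unfolding \<phi>_def .
    then have "(\<phi> has_derivative (*) 0) (at t)"
      by (rule has_derivative_eq_rhs) (simp add: fun_eq_iff linear_scale[OF lin] mink.scaleR_left zero)
    then show ?thesis
      unfolding has_field_derivative_def by (rule has_derivative_at_withinI)
  qed
  then have "\<exists>c. \<forall>t\<in>{0..1}. \<phi> t = c"
    using has_field_derivative_zero_constant[of "{0..1}" \<phi>] by simp
  then have "\<phi> 0 = \<phi> 1" by auto
  then show ?thesis by (simp add: \<phi>_def v_def mink.diff_left)
qed

text \<open>Orthogonality of increments polarizes to skewness of \<open>\<xi> x - \<xi> 0\<close>;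
  skewness and nondegeneracy then force linearity, without second derivatives.\<close>

lemma killing_field_affine:
  assumes \<xi>: "killing_field \<xi>"
  obtains A b where "linear A" "\<And>x y. mink (A x) y = - mink x (A y)" "\<xi> = (\<lambda>x. A x + b)"
proof
  define A where "A x = \<xi> x - \<xi> 0" for x
  have orth: "mink (A x - A y) (x - y) = 0" for x y
    using killing_field_orthogonal[OF \<xi>] by (simp add: A_def)
  have diag: "mink (A x) x = 0" for x
    using orth[of x 0] by (simp add: A_def)
  show skew: "mink (A x) y = - mink x (A y)" for x y
    using orth[of x y] diag[of x] diag[of y] mink_commute[of x "A y"]
    by (simp add: mink.diff_left mink.diff_right)
  show "linear A"
  proof (rule linearI)
    fix x y and c :: real
    have "mink (A (x + y) - (A x + A y)) w = 0" for w
      by (simp add: mink.diff_left mink.add_left skew)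
    then show "A (x + y) = A x + A y"
      using mink_nondegenerate eq_iff_diff_eq_0 by blast
    have "mink (A (c *\<^sub>R x) - c *\<^sub>R A x) w = 0" for w
      by (simp add: mink.diff_left mink.scaleR_left skew)
    then show "A (c *\<^sub>R x) = c *\<^sub>R A x"
      using mink_nondegenerate eq_iff_diff_eq_0 by blast
  qed
  show "\<xi> = (\<lambda>x. A x + \<xi> 0)" by (simp add: A_def)
qed

section \<open>Separation of variables\<close>

lemma hamiltonian_eq: "hamiltonian \<xi> (x, P) = 1 / 2 * (mink P P + mink (\<xi> x) (\<xi> x))"
  by (simp add: hamiltonian_def squared_norm_def sum_eta)

lemma squared_norm_diagonal:
  fixes a e :: "'n option \<Rightarrow> 'n::finite spacetime"
  assumes "linear A" and dual: "\<And>i j. a i \<bullet> e j = (if i = j then 1 else 0)"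
    and diag: "\<And>i j. i \<noteq> j \<Longrightarrow> mink (A (e i)) (A (e j)) = 0"
  shows "mink (A x + b) (A x + b) = mink b b +
    (\<Sum>j\<in>UNIV. mink (A (e j)) (A (e j)) * (a j \<bullet> x)\<^sup>2 + 2 * mink (A (e j)) b * (a j \<bullet> x))"
proof -
  interpret A: linear A by fact
  have "A x = A (\<Sum>j\<in>UNIV. (a j \<bullet> x) *\<^sub>R e j)"
    using dual_basis_expansion[OF dual, of x] by simp
  then have Ax: "A x = (\<Sum>j\<in>UNIV. (a j \<bullet> x) *\<^sub>R A (e j))"
    by (simp add: A.sum A.scale)
  have "mink (A x) (A x) = (\<Sum>i\<in>UNIV. \<Sum>j\<in>UNIV. (a i \<bullet> x) * (a j \<bullet> x) * mink (A (e j)) (A (e i)))"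
    by (simp add: Ax mink.sum_left mink.sum_right mink.scaleR_left mink.scaleR_right sum_distrib_left mult_ac)
  also have "\<dots> = (\<Sum>i\<in>UNIV. \<Sum>j\<in>UNIV. if i = j then mink (A (e i)) (A (e i)) * (a i \<bullet> x)\<^sup>2 else 0)"
    by (intro sum.cong refl) (simp add: diag power2_eq_square)
  finally have "mink (A x) (A x) = (\<Sum>i\<in>UNIV. mink (A (e i)) (A (e i)) * (a i \<bullet> x)\<^sup>2)" by simp
  moreover have "mink (A x) b = (\<Sum>j\<in>UNIV. mink (A (e j)) b * (a j \<bullet> x))"
    by (simp add: Ax mink.sum_left mink.scaleR_left mult_ac)
  moreover have "mink (A x + b) (A x + b) = mink b b + mink (A x) (A x) + 2 * mink (A x) b"
    by (simp add: mink.add_left mink.add_right mink_commute[of b "A x"])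
  ultimately show ?thesis
    by (simp add: sum.distrib sum_distrib_left mult_ac)
qed

text \<open>Only one factor \<open>P\<close> is expanded. In both applications
  \<open>lower (a j)\<close> is, up to sign, again a basis vector, possibly with another
  index.\<close>

lemma mink_dual_basis:
  fixes a e :: "'n option \<Rightarrow> 'n::finite spacetime"
  assumes dual: "\<And>i j. a i \<bullet> e j = (if i = j then 1 else 0)"
  shows "mink P P = (\<Sum>j\<in>UNIV. (P \<bullet> e j) * (P \<bullet> lower (a j)))"
proof -
  have "P = (\<Sum>j\<in>UNIV. (e j \<bullet> P) *\<^sub>R a j)"
    by (rule dual_basis_expansion) (auto simp: dual inner_commute[of "e _"])
  then have "mink P P = mink P (\<Sum>j\<in>UNIV. (e j \<bullet> P) *\<^sub>R a j)" by simp
  then show ?thesis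
    by (simp add: mink.sum_right mink.scaleR_right inner_lower inner_commute)
qed

lemma bounded_bilinear_mink_linear:
  fixes A :: "'n::finite spacetime \<Rightarrow> 'n spacetime"
  assumes "linear A"
  shows "bounded_bilinear (\<lambda>x y. mink (A x) (A y))"
  by (rule mink.comp) (simp_all add: assms flip: linear_conv_bounded_linear)

text \<open>\<open>mink\<close> is positive definite on the orthogonal hyperplane of
  \<open>v\<close>, so the pulled-back form can be diagonalized there. The eigenvector equation
  makes \<open>v\<close> orthogonal to that hyperplane for this form too.\<close>

lemma integrable_timelike_eigenvector:
  fixes A :: "'n::finite spacetime \<Rightarrow> 'n spacetime"
  assumes "linear A" and v: "mink v v < 0" and eigen: "\<And>x. mink (A v) (A x) = m * mink v x"
  shows "completely_integrable (hamiltonian (\<lambda>x. A x + b))"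
proof -
  interpret A: linear A by fact
  define W where "W = {x. lower v \<bullet> x = 0}"
  have W: "x \<in> W \<longleftrightarrow> mink v x = 0" for x by (simp add: W_def lower_inner)
  have "lower v \<noteq> 0" using v by (metis inner_zero_left lower_inner order_less_irrefl)
  then have "dim W = DIM('n spacetime) - 1" unfolding W_def by (rule dim_hyperplane)
  then have dim: "card (UNIV :: 'n set) \<le> dim W" by simp
  have "mink x x > 0" if "x \<in> W" "x \<noteq> 0" for x
    using mink_timelike_orthogonal_pos[OF v] that W mink_commute[of x v] by simp
  from simultaneous_diagonalization[OF mink.bounded_bilinear_axioms bounded_bilinear_mink_linear[OF \<open>linear A\<close>]
    mink_commute mink_commute finite_class.finite_UNIV _ dim this]
  obtain f :: "'n \<Rightarrow> 'n spacetime" where "(\<forall>i\<in>UNIV. f i \<in> W) \<and>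
      (\<forall>i\<in>UNIV. \<forall>j\<in>UNIV. mink (f i) (f j) = (if i = j then 1 else 0)) \<and>
      (\<forall>i\<in>UNIV. \<forall>j\<in>UNIV. i \<noteq> j \<longrightarrow> mink (A (f i)) (A (f j)) = 0)"
    using subspace_hyperplane[of "lower v"] W_def by blast
  then have f: "mink v (f i) = 0" "mink (f i) (f j) = (if i = j then 1 else 0)"
    "i \<noteq> j \<Longrightarrow> mink (A (f i)) (A (f j)) = 0" for i j
    by (simp_all add: W)
  \<comment> \<open>The time vector is scaled to square \<open>- 1\<close>; the signs
    \<open>s\<close> of the Gram matrix become the kinetic coefficients
    \<open>\<alpha>\<close>.\<close>
  define e where "e \<mu> = (case \<mu> of None \<Rightarrow> v /\<^sub>R sqrt (- mink v v) | Some i \<Rightarrow> f i)" for \<mu>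
  define s where "s \<mu> = (if \<mu> = None then - 1 else 1 :: real)" for \<mu> :: "'n option"
  define a where "a \<mu> = s \<mu> *\<^sub>R lower (e \<mu>)" for \<mu>
  have "inverse (sqrt (- mink v v)) * inverse (sqrt (- mink v v)) = 1 / (- mink v v)"
    using v by (simp add: divide_inverse flip: inverse_mult_distrib)
  then have gram: "mink (e \<mu>) (e \<nu>) = (if \<mu> = \<nu> then s \<mu> else 0)" for \<mu> \<nu>
    using v f mink_commute[of "f _" v]
    by (auto simp: e_def s_def mink.scaleR_left mink.scaleR_right mult.assoc[symmetric] split: option.split)
  then have dual: "a \<mu> \<bullet> e \<nu> = (if \<mu> = \<nu> then 1 else 0)" for \<mu> \<nu>
    by (simp add: a_def lower_inner s_def)
  have diag: "mink (A (e \<mu>)) (A (e \<nu>)) = 0" if "\<mu> \<noteq> \<nu>" for \<mu> \<nu>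
    using that f(1) eigen mink_commute[of "A (f _)" "A v"]
    by (cases \<mu>; cases \<nu>) (simp_all add: f(3) e_def A.scale mink.scaleR_left mink.scaleR_right)
  show ?thesis
  proof (rule quadratic_completely_integrable[OF dual, where \<alpha> = s and s = "\<lambda>_. 1" and \<beta> = "\<lambda>_. 0"
        and \<kappa> = "\<lambda>_. 0" and E = "mink b b / 2" and l = None
        and \<gamma> = "\<lambda>j. mink (A (e j)) (A (e j))" and \<delta> = "\<lambda>j. mink (A (e j)) b"])
    fix x P
    have "mink P P = (\<Sum>j\<in>UNIV. s j * (P \<bullet> e j)\<^sup>2)"
      by (subst mink_dual_basis[OF dual])
         (simp add: a_def linear_scale[OF linear_lower] power2_eq_square mult_ac)
    then show "hamiltonian (\<lambda>x. A x + b) (x, P) = mink b b / 2 + (\<Sum>j\<in>UNIV. 1 *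
      (s j / 2 * (P \<bullet> e j)\<^sup>2 + 0 * (P \<bullet> e j) * (P \<bullet> e None) +
       mink (A (e j)) (A (e j)) / 2 * (a j \<bullet> x)\<^sup>2 + mink (A (e j)) b * (a j \<bullet> x) + 0 * (P \<bullet> e j)))"
      using squared_norm_diagonal[OF \<open>linear A\<close> dual diag, of x b]
      by (simp add: hamiltonian_eq sum.distrib sum_distrib_left algebra_simps)
  qed (auto simp: s_def)
qed

text \<open>
  The fixed null direction \<open>N\<close> makes the position coordinate dual to \<open>N\<close> cyclic. A null rotation about \<open>N\<close>
  turns an arbitrary null complement \<open>U0\<close> into a \<open>U\<close> with \<open>A U\<close> orthogonal to \<open>A e\<^sub>i\<close>.
\<close>

lemma integrable_null_kernel:
  fixes A :: "'n::finite spacetime \<Rightarrow> 'n spacetime"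
  assumes "linear A" and skew: "\<And>x y. mink (A x) y = - mink x (A y)"
    and N: "N $ None = 1" "mink N N = 0" "A N = 0"
  shows "completely_integrable (hamiltonian (\<lambda>x. A x + b))"
proof -
  interpret A: linear A by fact
  interpret L: linear lower by (rule linear_lower)
  note mink_simps = mink.add_left mink.add_right mink.scaleR_left mink.scaleR_right
    mink.sum_left mink.sum_right mink.minus_left mink.minus_right
  obtain k :: 'n where True by simp
  \<comment> \<open>Two basis vectors are null: \<open>N\<close> takes the time index and its
    complement the spatial index \<open>k\<close>, leaving \<open>I\<close> for the others.\<close>
  define I where "I = - {k}"
  define U0 where "U0 = (- 1 / 2) *\<^sub>R lower N"
  have NN: "N \<bullet> N = 2" using N by (simp add: mink_def)
  have NU0: "mink N U0 = - 1" "mink U0 N = - 1" using NN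
    by (simp_all add: U0_def mink_simps mink_lower)
  have U0U0: "mink U0 U0 = 0" by (simp add: U0_def mink_simps N)
  \<comment> \<open>Orthogonality to \<open>N\<close> in both the Euclidean and the Minkowski sense
    kills the time component, so \<open>mink\<close> is positive definite on
    \<open>W\<close>.\<close>
  define W where "W = {x. N \<bullet> x = 0} \<inter> {x. lower N \<bullet> x = 0}"
  have W: "mink N x = 0" "mink x N = 0" "mink U0 x = 0" "mink x U0 = 0" if "x \<in> W" for x
    using that mink_commute[of N x]
    by (simp_all add: W_def lower_inner U0_def mink_simps mink_lower inner_commute[of x N])
  have "N \<noteq> 0" "lower N \<noteq> 0" using NN by (auto simp: lower_nth vec_eq_iff N(1) intro!: exI[of _ None])
  note dim_hyperplane[OF \<open>N \<noteq> 0\<close>] dim_hyperplane[OF \<open>lower N \<noteq> 0\<close>]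
  moreover have "dim {x + y |x y. x \<in> {x. N \<bullet> x = 0} \<and> y \<in> {x. lower N \<bullet> x = 0}} + dim W
      = dim {x. N \<bullet> x = 0} + dim {x. lower N \<bullet> x = 0}"
    unfolding W_def by (intro dim_sums_Int subspace_hyperplane)
  moreover have "dim {x + y |x y. x \<in> {x. N \<bullet> x = 0} \<and> y \<in> {x. lower N \<bullet> x = 0}} \<le> DIM('n spacetime)"
    by (rule dim_subset_UNIV)
  ultimately have dim: "card I \<le> dim W"
    by (simp add: I_def Compl_eq_Diff_UNIV card_Diff_singleton)
  have subW: "subspace W" unfolding W_def by (intro subspace_inter subspace_hyperplane)
  have pos: "mink x x > 0" if "x \<in> W" "x \<noteq> 0" for x
  proof -
    have "x $ None = 0" using that N(1) by (simp add: W_def lower_inner mink_def)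
    then show ?thesis using that by (simp add: mink_def)
  qed
  from simultaneous_diagonalization[OF mink.bounded_bilinear_axioms bounded_bilinear_mink_linear[OF \<open>linear A\<close>]
    mink_commute mink_commute finite subW dim pos]
  obtain f where "(\<forall>i\<in>I. f i \<in> W) \<and> (\<forall>i\<in>I. \<forall>j\<in>I. mink (f i) (f j) = (if i = j then 1 else 0)) \<and>
      (\<forall>i\<in>I. \<forall>j\<in>I. i \<noteq> j \<longrightarrow> mink (A (f i)) (A (f j)) = 0)"
    by (rule exE)
  then have f: "i \<in> I \<Longrightarrow> f i \<in> W" "i \<in> I \<Longrightarrow> j \<in> I \<Longrightarrow> mink (f i) (f j) = (if i = j then 1 else 0)"
    "i \<in> I \<Longrightarrow> j \<in> I \<Longrightarrow> i \<noteq> j \<Longrightarrow> mink (A (f i)) (A (f j)) = 0" for i j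
    by simp_all
  have AN: "mink (A x) N = 0" for x using skew N(3) by (simp add: mink.zero_right)
  \<comment> \<open>Chosen to cancel \<open>mink (A U0) (A (f i))\<close>. If the denominator is
    zero, \<open>A (f i)\<close> is null and orthogonal to \<open>N\<close>, hence a multiple of
    \<open>N\<close>; the numerator then vanishes too, as the range of \<open>A\<close> is
    orthogonal to \<open>N\<close>.\<close>
  define z where "z i = - mink (A U0) (A (f i)) / mink (A (f i)) (A (f i))" for i
  have z: "mink (A U0) (A (f i)) + z i * mink (A (f i)) (A (f i)) = 0" if "i \<in> I" for i
  proof (cases "mink (A (f i)) (A (f i)) = 0")
    case True
    from mink_causal_orthogonal(2)[OF N(1) eq_refl[OF N(2)] AN True]
    obtain t where "A (f i) = t *\<^sub>R N" ..
    then show ?thesis using AN N by (simp add: mink_simps)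
  qed (simp add: z_def)
  define Z where "Z = (\<Sum>i\<in>I. z i *\<^sub>R f i)"
  have "Z \<in> W" unfolding Z_def using f by (intro subspace_sum subW subspace_scale)
  have Zf: "mink Z (f i) = z i" "mink (f i) Z = z i" if "i \<in> I" for i
  proof -
    have "mink Z (f i) = (\<Sum>j\<in>I. if j = i then z j else 0)"
      unfolding Z_def mink_simps using f(2) that by (intro sum.cong) auto
    then show "mink Z (f i) = z i" using that by simp
    then show "mink (f i) Z = z i" by (simp add: mink_commute)
  qed
  have AZ: "mink (A Z) (A (f i)) = z i * mink (A (f i)) (A (f i))" if "i \<in> I" for i
  proof -
    have "mink (A Z) (A (f i)) = (\<Sum>j\<in>I. if j = i then z i * mink (A (f i)) (A (f i)) else 0)"
      unfolding Z_def mink_simps A.sum A.scale using f(3) that by (intro sum.cong) auto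
    then show ?thesis using that by simp
  qed
  \<comment> \<open>The null rotation fixing \<open>N\<close> with parameter \<open>Z\<close>: the
    multiples of \<open>N\<close> keep \<open>U\<close> null and every \<open>g i\<close> orthogonal
    to \<open>U\<close>. They are invisible to \<open>A\<close>, since
    \<open>A N = 0\<close>.\<close>
  define U where "U = U0 + Z + (mink Z Z / 2) *\<^sub>R N"
  define g where "g i = f i + z i *\<^sub>R N" for i
  note ZW = W[OF \<open>Z \<in> W\<close>] and fW = W[OF f(1)]
  have UU: "mink U U = 0" and NU: "mink N U = - 1" "mink U N = - 1"
    by (simp_all add: U_def mink_simps NU0 U0U0 N ZW)
  have gg: "mink (g i) (g j) = (if i = j then 1 else 0)" if "i \<in> I" "j \<in> I" for i j
    using that by (simp add: g_def mink_simps N fW f(2))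
  have gN: "mink (g i) N = 0" "mink N (g i) = 0" and gU: "mink (g i) U = 0" "mink U (g i) = 0"
    if "i \<in> I" for i
    using that by (simp_all add: g_def U_def mink_simps N fW ZW NU0 Zf)
  have AU: "A U = A U0 + A Z" and Ag: "A (g i) = A (f i)" for i
    by (simp_all add: U_def g_def A.add A.scale N)
  have AUg: "mink (A U) (A (g i)) = 0" "mink (A (g i)) (A U) = 0" if "i \<in> I" for i
  proof -
    show "mink (A U) (A (g i)) = 0"
      using z[OF that] by (simp add: AU Ag mink_simps AZ[OF that])
    then show "mink (A (g i)) (A U) = 0" by (simp add: mink_commute)
  qed
  define e where "e \<mu> = (case \<mu> of None \<Rightarrow> N | Some i \<Rightarrow> if i = k then U else g i)" for \<mu>
  define a where "a \<mu> = (case \<mu> of None \<Rightarrow> - lower U | Some i \<Rightarrow> if i = k then - lower N else lower (g i))" for \<mu>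
  have I: "i \<in> I \<longleftrightarrow> i \<noteq> k" for i by (simp add: I_def)
  have dual: "a \<mu> \<bullet> e \<nu> = (if \<mu> = \<nu> then 1 else 0)" for \<mu> \<nu>
    by (cases \<mu>; cases \<nu>)
      (simp_all add: a_def e_def lower_inner UU NU N(2) gN gU gg I)
  have diag: "mink (A (e \<mu>)) (A (e \<nu>)) = 0" if "\<mu> \<noteq> \<nu>" for \<mu> \<nu>
    using that
    by (cases \<mu>; cases \<nu>)
      (auto simp: e_def N(3) mink.zero_left mink.zero_right f(3) AUg[unfolded Ag] Ag I)
  \<comment> \<open>The mixed kinetic term \<open>- (P \<bullet> U) * (P \<bullet> N)\<close> is
    assigned to the index \<open>Some k\<close>. The index \<open>None\<close> gets weight zero in
    the Hamiltonian and supplies the conserved momentum \<open>P \<bullet> N\<close>.\<close>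
  define \<alpha> where "\<alpha> \<mu> = (if \<mu> = None \<or> \<mu> = Some k then 0 else 1 :: real)" for \<mu>
  define \<beta> where "\<beta> \<mu> = (if \<mu> = Some k then - 1 else 0 :: real)" for \<mu>
  have ae: "e None = N" "e (Some k) = U" "a None = - lower U" "a (Some k) = - lower N"
    "\<alpha> None = 0" "\<beta> None = 0" "\<alpha> (Some k) = 0" "\<beta> (Some k) = - 1"
    by (simp_all add: e_def a_def \<alpha>_def \<beta>_def)
  have ae_I: "e (Some i) = g i" "a (Some i) = lower (g i)" "\<alpha> (Some i) = 1" "\<beta> (Some i) = 0" if "i \<in> I" for i
    using that by (simp_all add: I e_def a_def \<alpha>_def \<beta>_def)
  show ?thesis
  proof (rule quadratic_completely_integrable[OF dual, where \<alpha> = \<alpha> and \<beta> = \<beta>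
        and s = "\<lambda>\<mu>. if \<mu> = None then 0 else 1" and \<kappa> = "\<lambda>\<mu>. if \<mu> = None then 1 else 0"
        and E = "mink b b / 2" and l = None
        and \<gamma> = "\<lambda>j. mink (A (e j)) (A (e j))" and \<delta> = "\<lambda>j. mink (A (e j)) b"])
    fix x P
    have split: "(\<Sum>\<mu>\<in>UNIV. h \<mu>) = h None + h (Some k) + (\<Sum>i\<in>I. h (Some i))" for h :: "'n option \<Rightarrow> real"
    proof -
      have "(\<Sum>i\<in>UNIV. h (Some i)) = h (Some k) + (\<Sum>i\<in>I. h (Some i))"
        by (subst sum.remove[of _ k]) (simp_all add: I_def Compl_eq_Diff_UNIV)
      then show ?thesis by (simp add: UNIV_option_conv sum.reindex)
    qed
    have "mink P P = - 2 * (P \<bullet> U) * (P \<bullet> N) + (\<Sum>i\<in>I. (P \<bullet> g i)\<^sup>2)"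
      by (subst mink_dual_basis[OF dual])
         (simp add: split ae ae_I L.neg power2_eq_square cong: sum.cong)
    then show "hamiltonian (\<lambda>x. A x + b) (x, P) = mink b b / 2 + (\<Sum>j\<in>UNIV. (if j = None then 0 else 1) *
      (\<alpha> j / 2 * (P \<bullet> e j)\<^sup>2 + \<beta> j * (P \<bullet> e j) * (P \<bullet> e None) +
       mink (A (e j)) (A (e j)) / 2 * (a j \<bullet> x)\<^sup>2 + mink (A (e j)) b * (a j \<bullet> x) +
       (if j = None then 1 else 0) * (P \<bullet> e j)))"
      using squared_norm_diagonal[OF \<open>linear A\<close> dual diag, of x b]
      by (simp add: hamiltonian_eq split ae ae_I N(3) mink.zero_left
          sum.distrib algebra_simps cong: sum.cong flip: sum_divide_distrib sum_distrib_left)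
         argo
  qed (auto simp: \<alpha>_def \<beta>_def e_def N(3) mink.zero_left)
qed

section \<open>Existence of causal eigenvectors\<close>

lemma causal_eigenvector:
  fixes A :: "'n::finite spacetime \<Rightarrow> 'n spacetime"
  assumes "linear A" and skew: "\<And>x y. mink (A x) y = - mink x (A y)"
  obtains (timelike) v m where "mink v v < 0" "\<And>x. mink (A v) (A x) = m * mink v x"
  | (null) N c where "N $ None = 1" "mink N N = 0" "A N = c *\<^sub>R N"
proof -
  interpret A: linear A by fact
  note mink_simps = mink.add_left mink.add_right mink.scaleR_left mink.scaleR_right
  define C where "C = {v :: 'n spacetime. v $ None = 1 \<and> mink v v \<le> 0}"
  have contm: "continuous_on S (\<lambda>v. mink v v)" and contA: "continuous_on S (\<lambda>v. mink (A v) (A v))"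
    for S :: "'n spacetime set"
    by (intro mink.continuous_on continuous_intros linear_continuous_on
        linear_conv_bounded_linear[THEN iffD1] \<open>linear A\<close>)+
  have "closed C" unfolding C_def
    by (intro closed_Collect_conj closed_Collect_eq closed_Collect_le continuous_intros contm)
  moreover have "norm v \<le> 2" if "v \<in> C" for v
  proof -
    have "v \<bullet> v \<le> 2\<^sup>2" using that by (auto simp: C_def mink_def)
    then show ?thesis by (simp add: norm_eq_sqrt_inner real_le_lsqrt)
  qed
  then have "bounded C" by (auto simp: bounded_iff)
  ultimately have "compact C" by (simp add: compact_eq_bounded_closed)
  have skew0: "mink (A v) v = 0" for v
    using skew[of v v] mink_commute[of v "A v"] by simp
  have nonneg: "mink (A v) (A v) \<ge> 0" if "v \<in> C" for v
    using mink_causal_orthogonal(1)[of v "A v"] that skew0 by (simp add: C_def)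
  \<comment> \<open>The infimum of this quotient need not be attained, as its denominator vanishes
    on the light cone; hence the passage to a quadratic form on the compact slice
    \<open>C\<close>.\<close>
  define R where "R = (\<lambda>v. mink (A v) (A v) / - mink v v) ` {v \<in> C. mink v v < 0}"
  have "axis None 1 \<in> {v \<in> C. mink v v < 0}"
    by (simp add: C_def mink_def inner_axis_axis)
  then have "axis None 1 \<in> C" "R \<noteq> {}" unfolding R_def by blast+
  have bdd: "bdd_below R"
    unfolding R_def by (rule bdd_belowI2[of _ 0]) (use nonneg in \<open>auto intro!: divide_nonneg_neg\<close>)
  define m where "m = Inf R"
  txt \<open>
    \<open>G\<close> is nonnegative on the causal cone and vanishes at some \<open>v\<close>: inside the cone its gradient
    vanishes too and \<open>v\<close> is an eigenvector of \<open>A\<^sup>2\<close>; on the light cone \<open>A v\<close> is null and orthogonal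
    to \<open>v\<close>, hence parallel to it.
  \<close>
  define G where "G x y = mink (A x) (A y) + m * mink x y" for x y
  have G_nonneg: "G v v \<ge> 0" if "v \<in> C" for v
  proof (cases "mink v v < 0")
    case True
    then have "m \<le> mink (A v) (A v) / - mink v v"
      unfolding m_def R_def using that bdd[unfolded R_def] by (intro cInf_lower) auto
    then have "m * (- mink v v) \<le> mink (A v) (A v)"
      using True by (subst (asm) pos_le_divide_eq) auto
    then show ?thesis by (simp add: G_def)
  next
    case False
    then show ?thesis using that nonneg[of v] by (simp add: C_def G_def)
  qed
  have "continuous_on C (\<lambda>v. G v v)"
    unfolding G_def by (intro continuous_intros contm contA)
  from continuous_attains_inf[OF \<open>compact C\<close> _ this] \<open>axis None 1 \<in> C\<close>
  obtain v where v: "v \<in> C" and min: "\<And>w. w \<in> C \<Longrightarrow> G v v \<le> G w w" by blast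
  \<comment> \<open>A positive minimum could be added to \<open>m\<close>: since
    \<open>- mink w w \<le> 1\<close> on \<open>C\<close>, the sum would still be a lower bound of
    \<open>R\<close>.\<close>
  have Gv: "G v v = 0"
  proof (rule ccontr)
    assume "G v v \<noteq> 0"
    then have pos: "G v v > 0" using G_nonneg[OF v] by simp
    have "m + G v v \<le> Inf R"
    proof (rule cInf_greatest[OF \<open>R \<noteq> {}\<close>])
      fix r assume "r \<in> R"
      then obtain w where w: "w \<in> C" "mink w w < 0" and r: "r = mink (A w) (A w) / - mink w w"
        by (auto simp: R_def)
      have "- mink w w \<le> 1" using w(1) inner_ge_zero[of "w - axis None 1"]
        by (simp add: C_def mink_def inner_diff inner_axis inner_axis')
      then have "G v v * (- mink w w) \<le> G v v" using pos by (intro mult_left_le) auto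
      also have "\<dots> \<le> G w w" by (rule min[OF w(1)])
      finally have "(m + G v v) * (- mink w w) \<le> mink (A w) (A w)"
        by (simp add: G_def algebra_simps)
      then show "m + G v v \<le> r" unfolding r using w(2) by (subst pos_le_divide_eq) auto
    qed
    then show False using pos by (simp add: m_def)
  qed
  show thesis
  proof (cases "mink v v < 0")
    case True
    \<comment> \<open>Homogeneity of degree two extends nonnegativity from the slice to timelike
      vectors of either time orientation.\<close>
    have G_cone: "G x x \<ge> 0" if "mink x x < 0" for x
    proof -
      define u where "u = x /\<^sub>R x $ None"
      have nz: "x $ None \<noteq> 0" by (rule timelike_nonzero_time[OF that])
      have "mink u u = (inverse (x $ None))\<^sup>2 * mink x x"
        by (simp add: u_def mink_simps power2_eq_square)
      then have "u \<in> C" using that nz by (simp add: C_def u_def mult_le_0_iff)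
      moreover have "x = (x $ None) *\<^sub>R u" using nz by (simp add: u_def)
      then have "G x x = G ((x $ None) *\<^sub>R u) ((x $ None) *\<^sub>R u)" by simp
      then have "G x x = (x $ None)\<^sup>2 * G u u"
        by (simp add: G_def A.scale mink_simps power2_eq_square algebra_simps)
      ultimately show ?thesis using G_nonneg by simp
    qed
    \<comment> \<open>Timelike vectors form an open set, so \<open>v\<close> may be varied in every
      direction \<open>x\<close>.\<close>
    have "G v x = 0" for x
    proof -
      have "isCont (\<lambda>t. mink (v + t *\<^sub>R x) (v + t *\<^sub>R x)) 0"
        by (intro mink.isCont continuous_intros)
      then have "((\<lambda>t. mink (v + t *\<^sub>R x) (v + t *\<^sub>R x)) \<longlongrightarrow> mink v v) (at 0)"
        by (simp add: isCont_def)
      then have "eventually (\<lambda>t. mink (v + t *\<^sub>R x) (v + t *\<^sub>R x) < 0) (at 0)"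
        using True by (rule order_tendstoD)
      then obtain \<epsilon> where "\<epsilon> > 0"
        and \<epsilon>: "\<And>t. t \<noteq> 0 \<Longrightarrow> dist t 0 < \<epsilon> \<Longrightarrow> mink (v + t *\<^sub>R x) (v + t *\<^sub>R x) < 0"
        by (auto simp: eventually_at)
      show ?thesis
      proof (rule local_min_linear_term_zero[OF \<open>\<epsilon> > 0\<close>])
        fix t :: real assume t: "\<bar>t\<bar> < \<epsilon>"
        have "0 \<le> G (v + t *\<^sub>R x) (v + t *\<^sub>R x)"
          using \<epsilon>[of t] t True by (intro G_cone) (cases "t = 0"; simp add: dist_real_def)
        also have "\<dots> = G v v + (2 * t * G v x + t\<^sup>2 * G x x)"
          by (simp add: G_def A.add A.scale mink_simps mink_commute[of x v] mink_commute[of "A x" "A v"]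
              power2_eq_square algebra_simps)
        finally show "0 \<le> 2 * t * G v x + t\<^sup>2 * G x x" using Gv by simp
      qed
    qed
    then have "mink (A v) (A x) = (- m) * mink v x" for x by (simp add: G_def add_eq_0_iff)
    with True show thesis by (rule timelike)
  next
    case False
    with v have vv: "v $ None = 1" "mink v v = 0" by (simp_all add: C_def)
    have "mink (A v) (A v) = 0" using Gv vv by (simp add: G_def)
    from mink_causal_orthogonal(2)[OF vv(1) eq_refl[OF vv(2)] skew0 this]
    show thesis by (rule null[OF vv])
  qed
qed

text \<open>Skewness pairs the eigenvalue \<open>c\<close> with \<open>- c\<close>. The two null
  eigenvectors span a plane on which the square of \<open>A\<close> is multiplication by the square
  of \<open>c\<close>, and this plane contains timelike vectors.\<close>

lemma null_eigenvector_imp_timelike: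
  fixes A :: "'n::finite spacetime \<Rightarrow> 'n spacetime"
  assumes "linear A" and skew: "\<And>x y. mink (A x) y = - mink x (A y)"
    and N: "N $ None = 1" "mink N N = 0" "A N = c *\<^sub>R N" and "c \<noteq> 0"
  obtains v where "mink v v < 0" "\<And>x. mink (A v) (A x) = - c\<^sup>2 * mink v x"
proof -
  interpret A: linear A by fact
  \<comment> \<open>\<open>B\<close> maps into the Minkowski-orthogonal complement of
    \<open>N\<close>, so it is not surjective and has a kernel, which consists of eigenvectors for
    \<open>- c\<close>.\<close>
  define B where "B x = A x + c *\<^sub>R x" for x
  have linB: "linear B"
    unfolding B_def by (intro linear_compose_add linear_scaleR \<open>linear A\<close>)
  have "mink (B x) N = 0" for x
    by (simp add: B_def mink.add_left mink.scaleR_left skew N mink.scaleR_right)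
  moreover have "mink (lower N) N \<noteq> 0"
    using N(1) by (auto simp: mink_lower)
  ultimately have "\<not> surj B" by (metis surjD)
  then have "\<not> inj B" using linear_injective_imp_surjective[OF linB] by auto
  then obtain M where M: "M \<noteq> 0" "B M = 0"
    using linear_injective_0[OF linB] by blast
  then have AM: "A M = (- c) *\<^sub>R M" by (simp add: B_def eq_neg_iff_add_eq_0)
  have MM: "mink M M = 0"
    using skew[of M M] \<open>c \<noteq> 0\<close> by (simp add: AM mink.minus_left mink.minus_right mink.scaleR_left mink.scaleR_right)
  have NM: "mink M N \<noteq> 0"
  proof
    assume "mink M N = 0"
    from mink_causal_orthogonal(2)[OF N(1) eq_refl[OF N(2)] this MM]
    obtain t where t: "M = t *\<^sub>R N" ..
    then have "A M $ None = t * c" by (simp add: A.scale N)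
    moreover have "A M $ None = - (t * c)" unfolding AM by (simp add: t N(1))
    ultimately have "t * c = 0" by linarith
    then show False using t M \<open>c \<noteq> 0\<close> N by simp
  qed
  \<comment> \<open>The coefficient \<open>mink M N\<close> makes the cross term negative whatever
    the sign of \<open>mink M N\<close>.\<close>
  define v where "v = N - mink M N *\<^sub>R M"
  have "mink v v = - 2 * (mink M N)\<^sup>2"
    by (simp add: v_def mink.diff_left mink.diff_right mink.scaleR_left mink.scaleR_right N MM
        mink_commute[of N M] power2_eq_square)
  then have "mink v v < 0" using NM by simp
  moreover have "mink (A v) (A x) = - c\<^sup>2 * mink v x" for x
  proof -
    have "A (A v) = c\<^sup>2 *\<^sub>R v"
      by (simp add: v_def A.add A.diff A.scale A.neg N AM power2_eq_square algebra_simps)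
    then show ?thesis using skew[of "A v" x] by (simp add: mink.scaleR_left)
  qed
  ultimately show thesis by (rule that)
qed

theorem theorem3:
  fixes \<xi> :: "'n::finite spacetime \<Rightarrow> 'n spacetime"
  assumes "killing_field \<xi>"
  shows "completely_integrable (hamiltonian \<xi>)"
proof -
  obtain A b where A: "linear A" "\<And>x y. mink (A x) y = - mink x (A y)" and \<xi>: "\<xi> = (\<lambda>x. A x + b)"
    using killing_field_affine[OF assms] by blast
  from A show ?thesis
  proof (cases rule: causal_eigenvector)
    case (timelike v m)
    then show ?thesis unfolding \<xi> by (rule integrable_timelike_eigenvector[OF A(1)])
  next
    case (null N c)
    show ?thesis
    proof (cases "c = 0")
      case True
      with null show ?thesis unfolding \<xi> by (intro integrable_null_kernel[OF A]) auto
    next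
      case False
      obtain v where "mink v v < 0" "\<And>x. mink (A v) (A x) = - c\<^sup>2 * mink v x"
        using null_eigenvector_imp_timelike[OF A null False] by blast
      then show ?thesis unfolding \<xi> by (rule integrable_timelike_eigenvector[OF A(1)])
    qed
  qed
qed

end
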